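(* Let $f=f_J$ with $f_J(\rho)=\rho(1-\rho)^J$, $J>0$. Then the associated threshold functions $\sigma=\sigma_J$ and $\gamma=\gamma_J$ are explicitly given as follows. For any $J>0$, $$\sigma_J(\rho)=\frac{\rho(1-\rho)}{J},\qquad \rho\in[0,1].$$ For any $J>1$ we have $\rho_c=\frac{2}{J+1}$ and $$\gamma_J(\rho)=\frac{\rho^2(1-\rho)\left(\rho-\frac{4J}{(J+1)^2}\right)}{J(\rho-\rho_c)^2},\qquad \rho\in(\rho_c,1].$$
   Context: For a flux $f$ on $[0,1]$, consider the ODE $$\mathrm d'(\rho)=\frac{f''(\rho)\mathrm d^2+(f(\rho)+2\rho f'(\rho))\mathrm d+\rho^2f(\rho)}{\rho f(\rho)}.\qquad(\ast)$$ The threshold function $\sigma$ associated with $f$ is the unique solution of $(\ast)$ starting at $\rho=0$ with initial conditions $\sigma(0)=0$ and $\sigma'(0)=-\frac{2f'(0)}{f''(0)}$, continued to the right in $[0,1]$. If $f$ switches from strictly concave on $[0,\rho_c)$ to strictly convex on $(\rho_c,1)$ at a point $\rho_c\in(0,1)$, the threshold function $\gamma$ associated with $f$ is the unique solution of $(\ast)$ to the right of $\rho_c$ with $\lim_{\rho\to\rho_c+}\gamma(\rho)=-\infty$, continued to the right in $(\rho_c,1]$. Values at $\rho=1$, where $(\ast)$ is singular, are understood as left limits. *)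

theory Defs
  imports "HOL-Analysis.Analysis"
begin

definition flux :: "real \<Rightarrow> real \<Rightarrow> real" where
  "flux J \<rho> = \<rho> * (1 - \<rho>) powr J"

text \<open>A flux lives on \<open>[0,1]\<close> only, so its derivatives are taken relative to \<open>[0,1]\<close>: they are
  one-sided at the end points and do not see the values of the function outside \<open>[0,1]\<close>.\<close>

definition deriv01 :: "(real \<Rightarrow> real) \<Rightarrow> real \<Rightarrow> real" where
  "deriv01 f \<rho> = vector_derivative f (at \<rho> within {0..1})"

definition threshold_rhs :: "(real \<Rightarrow> real) \<Rightarrow> real \<Rightarrow> real \<Rightarrow> real" where
  "threshold_rhs f \<rho> d =
     (deriv01 (deriv01 f) \<rho> * d\<^sup>2 + (f \<rho> + 2 * \<rho> * deriv01 f \<rho>) * d + \<rho>\<^sup>2 * f \<rho>) / (\<rho> * f \<rho>)"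

definition solves_threshold_ode :: "(real \<Rightarrow> real) \<Rightarrow> (real \<Rightarrow> real) \<Rightarrow> real set \<Rightarrow> bool" where
  "solves_threshold_ode f d I \<longleftrightarrow>
     (\<forall>\<rho>\<in>I. (d has_real_derivative threshold_rhs f \<rho> (d \<rho>)) (at \<rho>))"

text \<open>The equation is singular at \<open>\<rho> = 0\<close>; there only the initial conditions are imposed.\<close>

definition sigma_solution :: "(real \<Rightarrow> real) \<Rightarrow> real \<Rightarrow> (real \<Rightarrow> real) \<Rightarrow> bool" where
  "sigma_solution f r d \<longleftrightarrow>
     d 0 = 0 \<and>
     (d has_real_derivative (- 2 * deriv01 f 0 / deriv01 (deriv01 f) 0)) (at_right 0) \<and>
     solves_threshold_ode f d {0<..<r}"

text \<open>``The unique solution'' is understood to include local uniqueness: every solution of the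
  initial value problem on some \<open>[0,r)\<close> is a restriction of \<open>\<sigma>\<close>. The value at \<open>1\<close> is the left limit.\<close>

definition is_threshold_sigma :: "(real \<Rightarrow> real) \<Rightarrow> (real \<Rightarrow> real) \<Rightarrow> bool" where
  "is_threshold_sigma f \<sigma> \<longleftrightarrow>
     sigma_solution f 1 \<sigma> \<and>
     (\<forall>r d. 0 < r \<longrightarrow> r \<le> 1 \<longrightarrow> sigma_solution f r d \<longrightarrow> (\<forall>\<rho>\<in>{0..<r}. d \<rho> = \<sigma> \<rho>)) \<and>
     (\<sigma> \<longlongrightarrow> \<sigma> 1) (at_left 1)"

definition strictly_convex_on :: "real set \<Rightarrow> (real \<Rightarrow> real) \<Rightarrow> bool" where
  "strictly_convex_on S f \<longleftrightarrow>
     convex S \<and>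
     (\<forall>x\<in>S. \<forall>y\<in>S. \<forall>t. x \<noteq> y \<longrightarrow> 0 < t \<longrightarrow> t < 1 \<longrightarrow>
        f ((1 - t) * x + t * y) < (1 - t) * f x + t * f y)"

definition strictly_concave_on :: "real set \<Rightarrow> (real \<Rightarrow> real) \<Rightarrow> bool" where
  "strictly_concave_on S f \<longleftrightarrow> strictly_convex_on S (\<lambda>x. - f x)"

definition switches_at :: "(real \<Rightarrow> real) \<Rightarrow> real \<Rightarrow> bool" where
  "switches_at f \<rho>c \<longleftrightarrow>
     0 < \<rho>c \<and> \<rho>c < 1 \<and> strictly_concave_on {0..<\<rho>c} f \<and> strictly_convex_on {\<rho>c<..<1} f"

definition gamma_solution :: "(real \<Rightarrow> real) \<Rightarrow> real \<Rightarrow> real \<Rightarrow> (real \<Rightarrow> real) \<Rightarrow> bool" where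
  "gamma_solution f \<rho>c r d \<longleftrightarrow>
     filterlim d at_bot (at_right \<rho>c) \<and> solves_threshold_ode f d {\<rho>c<..<r}"

definition is_threshold_gamma :: "(real \<Rightarrow> real) \<Rightarrow> real \<Rightarrow> (real \<Rightarrow> real) \<Rightarrow> bool" where
  "is_threshold_gamma f \<rho>c \<gamma> \<longleftrightarrow>
     switches_at f \<rho>c \<and>
     gamma_solution f \<rho>c 1 \<gamma> \<and>
     (\<forall>r d. \<rho>c < r \<longrightarrow> r \<le> 1 \<longrightarrow> gamma_solution f \<rho>c r d \<longrightarrow> (\<forall>\<rho>\<in>{\<rho>c<..<r}. d \<rho> = \<gamma> \<rho>)) \<and>
     (\<gamma> \<longlongrightarrow> \<gamma> 1) (at_left 1)"

end

theory Submission
  imports Defs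
begin

text \<open>The function \<open>s(\<rho>) = \<rho> (1 - \<rho>) / J\<close> is a particular solution of the Riccati equation for \<open>d\<close>, so
  the difference \<open>w = d - s\<close> of any solution to it satisfies a Bernoulli equation
  \<open>w' = A w\<^sup>2 - (1 + \<rho>) / (\<rho> (1 - \<rho>)) w\<close> with \<open>A = f'' / (\<rho> f)\<close>. The initial conditions for \<open>\<sigma>\<close> give \<open>w = o(\<rho>)\<close>, which makes
  the linear term dominate near \<open>0\<close>; hence \<open>w\<^sup>2\<close> decreases there and vanishes. For \<open>\<gamma>\<close>, the
  function \<open>1 / w\<close> solves a linear equation with explicit integrating factor and tends to \<open>0\<close> at
  \<open>\<rho>c\<close>, which determines it.\<close>

section \<open>Strict convexity from the second derivative\<close>

text \<open>By the mean value theorem, the chords to the left and right of an intermediate point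
  have slopes \<open>f' a\<close> and \<open>f' b\<close> with \<open>a < b\<close>, and
  \<open>f'\<close> is strictly increasing.\<close>

lemma strictly_convex_on_deriv2_pos:
  fixes S :: "real set"
  assumes S: "convex S"
    and f': "\<And>x. x \<in> S \<Longrightarrow> (f has_real_derivative f' x) (at x)"
    and f'': "\<And>x. x \<in> S \<Longrightarrow> (f' has_real_derivative f'' x) (at x)"
    and pos: "\<And>x. x \<in> S \<Longrightarrow> f'' x > 0"
  shows "strictly_convex_on S f"
proof -
  have *: "f ((1 - t) * x + t * y) < (1 - t) * f x + t * f y"
    if xy: "x \<in> S" "y \<in> S" "x < y" and t: "0 < t" "t < 1" for x y t
  proof -
    define z where "z = (1 - t) * x + t * y"
    have zx: "z - x = t * (y - x)" and yz: "y - z = (1 - t) * (y - x)"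
      by (simp_all add: z_def algebra_simps)
    have "x < z" "z < y"
      using zx yz xy t by (metis diff_gt_0_iff_gt mult_pos_pos)+
    have sub: "{x..y} \<subseteq> S"
      using S xy by (metis atLeastAtMost_iff convex_contains_segment closed_segment_eq_real_ivl
          less_imp_le)
    obtain a where a: "x < a" "a < z" "f z - f x = (z - x) * f' a"
      using MVT2[OF \<open>x < z\<close>, of f f'] f' sub \<open>z < y\<close> by (smt (verit) atLeastAtMost_iff subsetD)
    obtain b where b: "z < b" "b < y" "f y - f z = (y - z) * f' b"
      using MVT2[OF \<open>z < y\<close>, of f f'] f' sub \<open>x < z\<close> by (smt (verit) atLeastAtMost_iff subsetD)
    have "f' a < f' b"
    proof (rule DERIV_pos_imp_increasing[of a b f'])
      show "a < b" using a b by simp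
      fix u assume "a \<le> u" "u \<le> b"
      then have "u \<in> S" using a b sub by auto
      then show "\<exists>D. (f' has_real_derivative D) (at u) \<and> D > 0"
        using f'' pos by blast
    qed
    \<comment> \<open>This product of positive factors is exactly the convexity gap
      \<open>(1 - t) * f x + t * f y - f z\<close>.\<close>
    then have "0 < t * (1 - t) * (y - x) * (f' b - f' a)"
      using t xy by simp
    also have "\<dots> = t * (f y - f z) - (1 - t) * (f z - f x)"
      unfolding a(3) b(3) zx yz by (simp add: algebra_simps)
    finally show ?thesis
      unfolding z_def[symmetric] by (simp add: algebra_simps)
  qed
  show ?thesis
    unfolding strictly_convex_on_def
  proof (intro conjI S ballI allI impI)
    fix x y t :: real
    assume "x \<in> S" "y \<in> S" "x \<noteq> y" "0 < t" "t < 1"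
    then show "f ((1 - t) * x + t * y) < (1 - t) * f x + t * f y"
      using *[of x y t] *[of y x "1 - t"] by (cases "x < y") (auto simp: algebra_simps)
  qed
qed

text \<open>Applied to \<open>f\<close> and to \<open>- f\<close> on the same pair of points, this
  yields a contradiction; that is how the switching point is shown to be unique.\<close>

lemma strictly_convex_on_midpoint:
  assumes "strictly_convex_on S f" "x \<in> S" "y \<in> S" "x \<noteq> y"
  shows "f ((x + y) / 2) < (f x + f y) / 2"
proof -
  have "\<forall>t. 0 < t \<longrightarrow> t < 1 \<longrightarrow> f ((1 - t) * x + t * y) < (1 - t) * f x + t * f y"
    using assms by (simp add: strictly_convex_on_def)
  from this[rule_format, of "1 / 2"] have "f ((1 - 1/2) * x + 1/2 * y) < (1 - 1/2) * f x + 1/2 * f y"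
    by simp
  then show ?thesis by (simp add: add_divide_distrib)
qed

section \<open>Uniqueness for linear and Riccati equations\<close>

text \<open>With \<open>K\<close> an antiderivative of \<open>k\<close> on the compact segment
  between the two points, the product \<open>w * exp (- K)\<close> is constant there.\<close>

lemma linear_ode_zero:
  fixes w k :: "real \<Rightarrow> real"
  assumes w: "\<And>x. x \<in> {a<..<b} \<Longrightarrow> (w has_real_derivative k x * w x) (at x)"
    and k: "continuous_on {a<..<b} k"
    and "x\<^sub>0 \<in> {a<..<b}" "w x\<^sub>0 = 0" and x: "x \<in> {a<..<b}"
  shows "w x = 0"
proof -
  define l u where "l = min x\<^sub>0 x" and "u = max x\<^sub>0 x"
  have sub: "{l..u} \<subseteq> {a<..<b}" and mem: "x\<^sub>0 \<in> {l..u}" "x \<in> {l..u}"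
    using assms by (auto simp: l_def u_def)
  define K where "K = (\<lambda>y. integral {l..y} k)"
  have K: "(K has_real_derivative k y) (at y within {l..u})" if "y \<in> {l..u}" for y
    unfolding K_def has_real_derivative_iff_has_vector_derivative
    by (rule integral_has_vector_derivative) (use that continuous_on_subset[OF k sub] in auto)
  have "((\<lambda>y. w y * exp (- K y)) has_real_derivative 0) (at y within {l..u})"
    if "y \<in> {l..u}" for y
    using that sub
    by (auto intro!: derivative_eq_intros K has_field_derivative_at_within[OF w])
  then have "w x * exp (- K x) = w x\<^sub>0 * exp (- K x\<^sub>0)"
    using mem has_field_derivative_zero_constant[of "{l..u}" "\<lambda>y. w y * exp (- K y)"]
    by (metis convex_real_interval(5))
  then show ?thesis using assms by simp
qed

text \<open>The term \<open>C\<close> cancels in \<open>d - e\<close>, and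
  \<open>d\<^sup>2 - e\<^sup>2\<close> factors, so the difference solves a linear equation with
  coefficient \<open>A * (d + e) + B\<close>.\<close>

lemma riccati_unique:
  fixes A B C d e :: "real \<Rightarrow> real"
  assumes A: "continuous_on {a<..<b} A" and B: "continuous_on {a<..<b} B"
    and d: "\<And>x. x \<in> {a<..<b} \<Longrightarrow> (d has_real_derivative A x * (d x)\<^sup>2 + B x * d x + C x) (at x)"
    and e: "\<And>x. x \<in> {a<..<b} \<Longrightarrow> (e has_real_derivative A x * (e x)\<^sup>2 + B x * e x + C x) (at x)"
    and "x\<^sub>0 \<in> {a<..<b}" "d x\<^sub>0 = e x\<^sub>0" "x \<in> {a<..<b}"
  shows "d x = e x"
proof -
  have cont: "continuous_on {a<..<b} d" "continuous_on {a<..<b} e"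
    by (rule DERIV_continuous_on[OF has_field_derivative_at_within], erule d)
       (rule DERIV_continuous_on[OF has_field_derivative_at_within], erule e)
  have "d x - e x = 0"
  proof (rule linear_ode_zero[of a b "\<lambda>x. d x - e x" "\<lambda>x. A x * (d x + e x) + B x"])
    show "((\<lambda>x. d x - e x) has_real_derivative (A y * (d y + e y) + B y) * (d y - e y)) (at y)"
      if "y \<in> {a<..<b}" for y
      using that by (auto intro!: derivative_eq_intros d e simp: power2_eq_square algebra_simps)
    show "continuous_on {a<..<b} (\<lambda>y. A y * (d y + e y) + B y)"
      by (intro continuous_intros A B cont)
  qed (use assms in auto)
  then show ?thesis by simp
qed

section \<open>The flux, its derivatives and its inflection point\<close>

definition flux' :: "real \<Rightarrow> real \<Rightarrow> real" where
  "flux' J \<rho> = (1 - \<rho>) powr (J - 1) * (1 - (J + 1) * \<rho>)"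

text \<open>With the power of \<open>1 - \<rho>\<close> factored out, the sign for
  \<open>\<rho> < 1\<close> and \<open>J > 0\<close> is that of the linear factor, which vanishes at
  \<open>2 / (J + 1)\<close>.\<close>

definition flux'' :: "real \<Rightarrow> real \<Rightarrow> real" where
  "flux'' J \<rho> = J * (1 - \<rho>) powr (J - 2) * ((J + 1) * \<rho> - 2)"

text \<open>The base \<open>1 - \<rho>\<close> is positive on a full neighbourhood, also at
  \<open>\<rho> = 0\<close>, so the one-sided derivative at \<open>0\<close> follows by
  restriction.\<close>

lemma has_real_derivative_flux:
  assumes "\<rho> < 1"
  shows "(flux J has_real_derivative flux' J \<rho>) (at \<rho>)"
proof -
  have "(1 - \<rho>) powr J = (1 - \<rho>) powr (J - 1) * (1 - \<rho>)"
    using assms powr_add[of "1 - \<rho>" "J - 1" 1] by simp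
  then show ?thesis
    unfolding flux_def[abs_def] flux'_def using assms
    by (auto intro!: derivative_eq_intros simp: algebra_simps)
qed

lemma has_real_derivative_flux':
  assumes "\<rho> < 1"
  shows "(flux' J has_real_derivative flux'' J \<rho>) (at \<rho>)"
proof -
  have powr_eq: "(1 - \<rho>) powr (J - 1) = (1 - \<rho>) powr (J - 2) * (1 - \<rho>)"
    using assms powr_add[of "1 - \<rho>" "J - 2" 1] by simp
  have "((\<lambda>\<rho>. (1 - \<rho>) powr (J - 1) * (1 - (J + 1) * \<rho>)) has_real_derivative
      - ((J - 1) * (1 - \<rho>) powr (J - 2) * (1 - (J + 1) * \<rho>)) - (J + 1) * (1 - \<rho>) powr (J - 1)) (at \<rho>)"
    using assms by (auto intro!: derivative_eq_intros simp: algebra_simps)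
  also have "- ((J - 1) * (1 - \<rho>) powr (J - 2) * (1 - (J + 1) * \<rho>)) - (J + 1) * (1 - \<rho>) powr (J - 1) = flux'' J \<rho>"
    unfolding powr_eq flux''_def by (simp add: algebra_simps)
  finally show ?thesis
    unfolding flux'_def[abs_def] .
qed

text \<open>Derivatives within a nondegenerate interval are unique, including at its end
  points.\<close>

lemma deriv01_eqI:
  assumes "(f has_real_derivative D) (at x within {0..1})" "x \<in> {0..1}"
  shows "deriv01 f x = D"
  using assms unfolding deriv01_def has_real_derivative_iff_has_vector_derivative
  by (intro vector_derivative_within_cbox[where a=0 and b=1, unfolded cbox_interval]) auto

lemma deriv01_flux: "\<rho> \<in> {0..<1} \<Longrightarrow> deriv01 (flux J) \<rho> = flux' J \<rho>"
  by (intro deriv01_eqI has_field_derivative_at_within[OF has_real_derivative_flux]) auto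

lemma deriv01_deriv01_flux:
  assumes "\<rho> \<in> {0..<1}"
  shows "deriv01 (deriv01 (flux J)) \<rho> = flux'' J \<rho>"
proof (rule deriv01_eqI)
  show "(deriv01 (flux J) has_real_derivative flux'' J \<rho>) (at \<rho> within {0..1})"
  \<comment> \<open>The first derivative is identified with \<open>flux'\<close> only to the left of
    \<open>1\<close>; the radius \<open>1 - \<rho>\<close> keeps the comparison there.\<close>
  proof (rule has_field_derivative_transform_within)
    show "(flux' J has_real_derivative flux'' J \<rho>) (at \<rho> within {0..1})"
      using assms by (intro has_field_derivative_at_within[OF has_real_derivative_flux']) auto
    show "1 - \<rho> > 0" "\<rho> \<in> {0..1}" using assms by auto
    show "flux' J x = deriv01 (flux J) x" if "x \<in> {0..1}" "dist x \<rho> < 1 - \<rho>" for x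
      using that by (intro deriv01_flux[symmetric]) (auto simp: dist_real_def)
  qed
qed (use assms in auto)

text \<open>The sign of \<open>flux''\<close> shows that \<open>2 / (J + 1)\<close> is a switching
  point. Two switching points \<open>p < q\<close> would make the function both strictly convex and
  strictly concave on the interval between them.\<close>

lemma switches_at_flux_iff:
  assumes "J > 1"
  shows "switches_at (flux J) \<rho>c \<longleftrightarrow> \<rho>c = 2 / (J + 1)"
proof
  define c where "c = 2 / (J + 1)"
  have c: "0 < c" "c < 1" using assms by (auto simp: c_def)
  have "strictly_concave_on {0..<c} (flux J)"
    unfolding strictly_concave_on_def
  proof (rule strictly_convex_on_deriv2_pos)
    fix x :: real
    show "x \<in> {0..<c} \<Longrightarrow> ((\<lambda>x. - flux J x) has_real_derivative - flux' J x) (at x)"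
      using c by (intro DERIV_minus has_real_derivative_flux) auto
    show "x \<in> {0..<c} \<Longrightarrow> ((\<lambda>x. - flux' J x) has_real_derivative - flux'' J x) (at x)"
      using c by (intro DERIV_minus has_real_derivative_flux') auto
    assume "x \<in> {0..<c}"
    then have "x < c" by simp
    then have "(J + 1) * x - 2 < 0" "x < 1"
      using assms c(2) less_trans[of x c 1] by (simp_all add: c_def field_simps)
    then show "- flux'' J x > 0"
      using assms by (simp add: flux''_def mult_pos_neg)
  qed auto
  moreover have "strictly_convex_on {c<..<1} (flux J)"
  proof (rule strictly_convex_on_deriv2_pos)
    fix x :: real
    show "x \<in> {c<..<1} \<Longrightarrow> (flux J has_real_derivative flux' J x) (at x)"
      by (intro has_real_derivative_flux) auto
    show "x \<in> {c<..<1} \<Longrightarrow> (flux' J has_real_derivative flux'' J x) (at x)"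
      by (intro has_real_derivative_flux') auto
    assume "x \<in> {c<..<1}"
    then have "(J + 1) * x - 2 > 0" "x < 1"
      using assms by (auto simp: c_def field_simps)
    then show "flux'' J x > 0"
      using assms by (simp add: flux''_def)
  qed auto
  ultimately have sw: "switches_at (flux J) c"
    using c by (auto simp: switches_at_def)
  then show "\<rho>c = 2 / (J + 1) \<Longrightarrow> switches_at (flux J) \<rho>c"
    by (simp add: c_def)
  have False if "switches_at f p" "switches_at f q" "p < q" for f p q
  proof -
    \<comment> \<open>The points cutting the segment from \<open>p\<close> to \<open>q\<close> into
      thirds lie in the convex range of \<open>p\<close> and in the concave range of
      \<open>q\<close>.\<close>
    define x y where "x = (2 * p + q) / 3" and "y = (p + 2 * q) / 3"
    have "x \<in> {p<..<1}" "y \<in> {p<..<1}" "x \<in> {0..<q}" "y \<in> {0..<q}" "x \<noteq> y"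
      using that by (auto simp: switches_at_def x_def y_def)
    then have "f ((x + y) / 2) < (f x + f y) / 2" "- f ((x + y) / 2) < (- f x + - f y) / 2"
      using that(1,2) unfolding switches_at_def strictly_concave_on_def
      by (blast dest: strictly_convex_on_midpoint)+
    then show False by simp
  qed
  from this[of "flux J" c \<rho>c] this[of "flux J" \<rho>c c] sw
  show "\<rho>c = 2 / (J + 1)" if "switches_at (flux J) \<rho>c"
    using that by (metis c_def linorder_neqE_linordered_idom)
qed

section \<open>Reduction of the threshold equation to a Bernoulli equation\<close>

text \<open>This is \<open>f'' / (\<rho> * f)\<close>, where the powers of \<open>1 - \<rho>\<close>
  depending on \<open>J\<close> have cancelled.\<close>

definition quad_coeff :: "real \<Rightarrow> real \<Rightarrow> real" where
  "quad_coeff J \<rho> = J * ((J + 1) * \<rho> - 2) / (\<rho>\<^sup>2 * (1 - \<rho>)\<^sup>2)"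

text \<open>This is \<open>2 * A * s + (f + 2 * \<rho> * f') / (\<rho> * f)\<close> with
  \<open>A\<close> the quadratic coefficient and \<open>s = \<rho> * (1 - \<rho>) / J\<close>; the
  dependence on \<open>J\<close> drops out.\<close>

definition lin_coeff :: "real \<Rightarrow> real" where
  "lin_coeff \<rho> = - ((1 + \<rho>) / (\<rho> * (1 - \<rho>)))"

lemma continuous_on_quad_coeff: "S \<subseteq> {0<..<1} \<Longrightarrow> continuous_on S (quad_coeff J)"
  unfolding quad_coeff_def[abs_def] by (intro continuous_intros) auto

lemma continuous_on_lin_coeff: "S \<subseteq> {0<..<1} \<Longrightarrow> continuous_on S lin_coeff"
  unfolding lin_coeff_def[abs_def] by (intro continuous_intros) auto

text \<open>All flux terms share the factor \<open>P = (1 - \<rho>) powr (J - 2)\<close>, which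
  cancels and leaves a rational identity. The first summand is the derivative of \<open>s\<close>,
  so the case \<open>w = 0\<close> says that \<open>s\<close> is a solution.\<close>

lemma threshold_rhs_flux_shift:
  assumes "J > 0" and \<rho>: "\<rho> \<in> {0<..<1}"
  shows "threshold_rhs (flux J) \<rho> (\<rho> * (1 - \<rho>) / J + w)
    = (1 - 2 * \<rho>) / J + (quad_coeff J \<rho> * w\<^sup>2 + lin_coeff \<rho> * w)"
proof -
  define P q d where "P = (1 - \<rho>) powr (J - 2)" and "q = 1 - \<rho>" and "d = \<rho> * q / J + w"
  have pos: "P > 0" "q > 0" "\<rho> > 0" using \<rho> by (auto simp: P_def q_def)
  have "(1 - \<rho>) powr (J - 1) = P * q"
    using \<rho> powr_add[of "1 - \<rho>" "J - 2" 1] by (simp add: P_def q_def)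
  moreover have "(1 - \<rho>) powr J = P * q\<^sup>2"
    using \<rho> powr_add[of "1 - \<rho>" "J - 2" 2] by (simp add: P_def q_def)
  ultimately have "threshold_rhs (flux J) \<rho> d = (J * P * ((J + 1) * \<rho> - 2) * d\<^sup>2
      + (\<rho> * (P * q\<^sup>2) + 2 * \<rho> * (P * q * (1 - (J + 1) * \<rho>))) * d + \<rho>\<^sup>2 * (\<rho> * (P * q\<^sup>2)))
      / (\<rho> * (\<rho> * (P * q\<^sup>2)))"
    using \<rho> by (simp add: threshold_rhs_def deriv01_flux deriv01_deriv01_flux flux_def flux'_def
        flux''_def P_def)
  also have "\<dots> = (J * ((J + 1) * \<rho> - 2) * d\<^sup>2
      + (\<rho> * q\<^sup>2 + 2 * \<rho> * q * (1 - (J + 1) * \<rho>)) * d + \<rho> ^ 3 * q\<^sup>2) / (\<rho>\<^sup>2 * q\<^sup>2)"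
    using pos by (simp add: divide_simps) (simp add: algebra_simps power2_eq_square power3_eq_cube)
  also have "\<dots> = (1 - 2 * \<rho>) / J + (J * ((J + 1) * \<rho> - 2) / (\<rho>\<^sup>2 * q\<^sup>2) * w\<^sup>2 - (1 + \<rho>) / (\<rho> * q) * w)"
    using pos assms unfolding d_def
    by (simp add: divide_simps) (simp add: q_def, algebra)
  finally show ?thesis
    by (simp add: d_def q_def quad_coeff_def lin_coeff_def)
qed

lemma solves_threshold_ode_flux_iff:
  assumes "J > 0" "0 \<le> a" "b \<le> 1"
  shows "solves_threshold_ode (flux J) d {a<..<b} \<longleftrightarrow>
    (\<forall>\<rho>\<in>{a<..<b}. ((\<lambda>\<rho>. d \<rho> - \<rho> * (1 - \<rho>) / J) has_real_derivative
      quad_coeff J \<rho> * (d \<rho> - \<rho> * (1 - \<rho>) / J)\<^sup>2 + lin_coeff \<rho> * (d \<rho> - \<rho> * (1 - \<rho>) / J)) (at \<rho>))"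
  unfolding solves_threshold_ode_def
proof (intro ball_cong refl)
  fix \<rho> assume \<rho>: "\<rho> \<in> {a<..<b}"
  define w where "w = (\<lambda>\<rho>. d \<rho> - \<rho> * (1 - \<rho>) / J)"
  have s: "((\<lambda>\<rho>. \<rho> * (1 - \<rho>) / J) has_real_derivative (1 - 2 * \<rho>) / J) (at \<rho>)"
    using assms by (auto intro!: derivative_eq_intros)
  have rhs: "threshold_rhs (flux J) \<rho> (d \<rho>)
      = (1 - 2 * \<rho>) / J + (quad_coeff J \<rho> * (w \<rho>)\<^sup>2 + lin_coeff \<rho> * w \<rho>)"
    using threshold_rhs_flux_shift[OF assms(1), of \<rho> "w \<rho>"] \<rho> assms by (simp add: w_def)
  have "(d has_real_derivative threshold_rhs (flux J) \<rho> (d \<rho>)) (at \<rho>) \<longleftrightarrow>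
      (w has_real_derivative quad_coeff J \<rho> * (w \<rho>)\<^sup>2 + lin_coeff \<rho> * w \<rho>) (at \<rho>)"
  proof
    assume "(d has_real_derivative threshold_rhs (flux J) \<rho> (d \<rho>)) (at \<rho>)"
    from DERIV_diff[OF this s] show "(w has_real_derivative quad_coeff J \<rho> * (w \<rho>)\<^sup>2 + lin_coeff \<rho> * w \<rho>) (at \<rho>)"
      unfolding rhs by (simp add: w_def)
  next
    assume "(w has_real_derivative quad_coeff J \<rho> * (w \<rho>)\<^sup>2 + lin_coeff \<rho> * w \<rho>) (at \<rho>)"
    from DERIV_add[OF s this] show "(d has_real_derivative threshold_rhs (flux J) \<rho> (d \<rho>)) (at \<rho>)"
      unfolding rhs by (simp add: w_def)
  qed
  then show "(d has_real_derivative threshold_rhs (flux J) \<rho> (d \<rho>)) (at \<rho>) \<longleftrightarrow>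
      ((\<lambda>\<rho>. d \<rho> - \<rho> * (1 - \<rho>) / J) has_real_derivative
      quad_coeff J \<rho> * (d \<rho> - \<rho> * (1 - \<rho>) / J)\<^sup>2 + lin_coeff \<rho> * (d \<rho> - \<rho> * (1 - \<rho>) / J)) (at \<rho>)"
    by (simp add: w_def)
qed

text \<open>After the shift by \<open>s\<close> both functions solve the same Riccati equation with
  zero constant term, and its coefficients are continuous inside the unit interval. Agreement at one
  point therefore spreads to the whole interval.\<close>

lemma solves_threshold_ode_flux_unique:
  assumes "J > 0" "0 \<le> a" "b \<le> 1"
    and "solves_threshold_ode (flux J) d {a<..<b}" "solves_threshold_ode (flux J) e {a<..<b}"
    and "x\<^sub>0 \<in> {a<..<b}" "d x\<^sub>0 = e x\<^sub>0" "x \<in> {a<..<b}"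
  shows "d x = e x"
proof -
  define w where "w = (\<lambda>d \<rho>. d \<rho> - \<rho> * (1 - \<rho>) / J)"
  have sub: "{a<..<b} \<subseteq> {0<..<1}" using assms by auto
  have "w d x = w e x"
  proof (rule riccati_unique[of a b "quad_coeff J" lin_coeff "w d" "\<lambda>_. 0" "w e" x\<^sub>0])
    show "(w d has_real_derivative quad_coeff J x * (w d x)\<^sup>2 + lin_coeff x * w d x + 0) (at x)"
      "(w e has_real_derivative quad_coeff J x * (w e x)\<^sup>2 + lin_coeff x * w e x + 0) (at x)"
      if "x \<in> {a<..<b}" for x
      using that assms(4,5) unfolding solves_threshold_ode_flux_iff[OF assms(1-3)] w_def by simp_all
  qed (use assms continuous_on_quad_coeff[OF sub] continuous_on_lin_coeff[OF sub] in
      \<open>simp_all add: w_def\<close>)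
  then show ?thesis by (simp add: w_def)
qed

lemma solves_threshold_ode_cong:
  assumes "solves_threshold_ode f e S" "open S" "\<And>x. x \<in> S \<Longrightarrow> d x = e x"
  shows "solves_threshold_ode f d S"
  unfolding solves_threshold_ode_def
proof
  fix x assume x: "x \<in> S"
  have "(e has_real_derivative threshold_rhs f x (d x)) (at x)"
    using assms x by (simp add: solves_threshold_ode_def)
  then show "(d has_real_derivative threshold_rhs f x (d x)) (at x)"
    by (rule has_field_derivative_transform_within_open[OF _ assms(2) x]) (simp add: assms(3))
qed

section \<open>The threshold function \<sigma>\<close>

lemma sigma_solution_flux_formula:
  assumes J: "J > 0" and d: "\<And>\<rho>. \<rho> \<in> {0..<1} \<Longrightarrow> d \<rho> = \<rho> * (1 - \<rho>) / J"
  shows "sigma_solution (flux J) 1 d"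
  unfolding sigma_solution_def
proof (intro conjI)
  show "d 0 = 0" using d[of 0] by simp
  \<comment> \<open>The set \<open>{0..}\<close> contains \<open>0\<close>, as the transfer from the
    formula to \<open>d\<close> requires; restriction then gives \<open>at_right 0\<close>. The
    slope is \<open>1 / J\<close> because \<open>f' 0 = 1\<close> and
    \<open>f'' 0 = - 2 * J\<close>.\<close>
  have "((\<lambda>\<rho>. \<rho> * (1 - \<rho>) / J) has_real_derivative 1 / J) (at 0 within {0..})"
    using J by (auto intro!: derivative_eq_intros)
  then have "(d has_real_derivative 1 / J) (at 0 within {0..})"
    by (rule has_field_derivative_transform_within[where d = 1]) (auto simp: dist_real_def d)
  then have "(d has_real_derivative 1 / J) (at_right 0)"
    by (rule has_field_derivative_subset) auto
  then show "(d has_real_derivative - 2 * deriv01 (flux J) 0 / deriv01 (deriv01 (flux J)) 0) (at_right 0)"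
    using J by (simp add: deriv01_flux deriv01_deriv01_flux flux'_def flux''_def)
  have "solves_threshold_ode (flux J) (\<lambda>\<rho>. \<rho> * (1 - \<rho>) / J) {0<..<1}"
    using J by (subst solves_threshold_ode_flux_iff) auto
  then show "solves_threshold_ode (flux J) d {0<..<1}"
    by (rule solves_threshold_ode_cong) (auto simp: d)
qed

lemma sigma_solution_flux_unique:
  assumes J: "J > 0" and r: "0 < r" "r \<le> 1" and d: "sigma_solution (flux J) r d"
    and \<rho>: "\<rho> \<in> {0..<r}"
  shows "d \<rho> = \<rho> * (1 - \<rho>) / J"
proof -
  define w where "w = (\<lambda>\<rho>. d \<rho> - \<rho> * (1 - \<rho>) / J)"
  have d0: "d 0 = 0" and d0': "(d has_real_derivative 1 / J) (at_right 0)"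
    and ode: "solves_threshold_ode (flux J) d {0<..<r}"
    using d J by (simp_all add: sigma_solution_def deriv01_flux deriv01_deriv01_flux flux'_def flux''_def)
  have s0': "((\<lambda>\<rho>. \<rho> * (1 - \<rho>) / J) has_real_derivative 1 / J) (at_right 0)"
    using J by (auto intro!: derivative_eq_intros)
  \<comment> \<open>Both \<open>d\<close> and \<open>s\<close> vanish at \<open>0\<close> with the
    same slope there.\<close>
  have w_quot: "((\<lambda>y. w y / y) \<longlongrightarrow> 0) (at_right 0)"
    using DERIV_diff[OF d0' s0'] by (simp add: has_field_derivative_iff w_def d0)
  have "((\<lambda>y. w y / y * y) \<longlongrightarrow> 0 * 0) (at_right 0)"
    by (intro tendsto_mult w_quot tendsto_ident_at)
  then have "((\<lambda>y. w y / y * y) \<longlongrightarrow> 0) (at_right 0)" by simp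
  then have w_lim: "(w \<longlongrightarrow> 0) (at_right 0)"
    by (rule Lim_transform_eventually) (auto simp: eventually_at_filter)
  \<comment> \<open>This is \<open>y\<close> times
    \<open>quad_coeff J y * w y + lin_coeff y\<close>, so that \<open>w' = (h / y) * w\<close>. Its
    limit at \<open>0\<close> is \<open>- 1\<close>, since the quadratic part carries the factor
    \<open>w y / y\<close>.\<close>
  define h where "h = (\<lambda>y. J * ((J + 1) * y - 2) / (1 - y)\<^sup>2 * (w y / y) - (1 + y) / (1 - y))"
  have "(h \<longlongrightarrow> J * ((J + 1) * 0 - 2) / (1 - 0)\<^sup>2 * 0 - (1 + 0) / (1 - 0)) (at_right 0)"
    unfolding h_def by (intro tendsto_intros w_quot) auto
  then have "eventually (\<lambda>y. h y < 0) (at_right 0)"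
    by (rule order_tendstoD(2)) simp
  then obtain b0 where "b0 > 0" "\<And>y. 0 < y \<Longrightarrow> y < b0 \<Longrightarrow> h y < 0"
    by (auto simp: eventually_at_right_field)
  then obtain b where b: "b > 0" "b \<le> r" and h: "\<And>y. 0 < y \<Longrightarrow> y < b \<Longrightarrow> h y < 0"
    using r by (metis less_eq_real_def min.bounded_iff min_less_iff_conj order_refl linorder_le_cases order.strict_trans2)
  have w': "(w has_real_derivative h y / y * w y) (at y)" if y: "0 < y" "y < r" for y
  proof -
    have eq: "quad_coeff J y * (w y)\<^sup>2 + lin_coeff y * w y = h y / y * w y"
      using y r by (simp add: quad_coeff_def lin_coeff_def h_def divide_simps)
        (simp add: algebra_simps power2_eq_square)
    have "(w has_real_derivative quad_coeff J y * (w y)\<^sup>2 + lin_coeff y * w y) (at y)"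
      using ode y r J solves_threshold_ode_flux_iff[of J 0 r d] by (simp add: w_def)
    then show ?thesis unfolding eq .
  qed
  \<comment> \<open>On \<open>(0, b)\<close> the square of \<open>w\<close> is nonincreasing, so its
    value at \<open>b / 2\<close> is at most its limit \<open>0\<close> from the right. One zero of
    \<open>w\<close> suffices for the uniqueness result away from the singularity.\<close>
  have "(w (b / 2))\<^sup>2 \<le> 0"
  proof (rule tendsto_lowerbound)
    show "((\<lambda>y. (w y)\<^sup>2) \<longlongrightarrow> 0) (at_right 0)"
      using tendsto_power[OF w_lim, of 2] by simp
    have "(w (b / 2))\<^sup>2 \<le> (w y)\<^sup>2" if y: "0 < y" "y < b / 2" for y
    proof (rule DERIV_nonpos_imp_nonincreasing[where f = "\<lambda>y. (w y)\<^sup>2"])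
      fix x assume x: "y \<le> x" "x \<le> b / 2"
      have "((\<lambda>y. (w y)\<^sup>2) has_real_derivative 2 * (h x / x) * (w x)\<^sup>2) (at x)"
        using x y b w'[of x] by (auto intro!: derivative_eq_intros simp: power2_eq_square)
      moreover have "2 * (h x / x) * (w x)\<^sup>2 \<le> 0"
        using x y b h[of x] by (intro mult_nonpos_nonneg[OF _ zero_le_power2]) (auto simp: divide_le_0_iff)
      ultimately show "\<exists>D. ((\<lambda>y. (w y)\<^sup>2) has_real_derivative D) (at x) \<and> D \<le> 0" by blast
    qed (use y in simp)
    then show "\<forall>\<^sub>F y in at_right 0. (w (b / 2))\<^sup>2 \<le> (w y)\<^sup>2"
      using b by (auto simp: eventually_at_right_field intro!: exI[of _ "b / 2"])
  qed simp
  then have eq: "d (b / 2) = b / 2 * (1 - b / 2) / J" by (simp add: w_def)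
  show ?thesis
  proof (cases "\<rho> = 0")
    case False
    have "solves_threshold_ode (flux J) (\<lambda>\<rho>. \<rho> * (1 - \<rho>) / J) {0<..<r}"
      using J r by (subst solves_threshold_ode_flux_iff) auto
    from solves_threshold_ode_flux_unique[OF J _ r(2) ode this _ eq, of \<rho>] show ?thesis
      using False \<rho> b by simp
  qed (simp add: d0)
qed

text \<open>Uniqueness of limits recovers the value at the singular end point \<open>1\<close>,
  where the equation itself gives no information.\<close>

lemma tendsto_at_left_eqI:
  fixes f g :: "real \<Rightarrow> real"
  assumes "(f \<longlongrightarrow> f b) (at_left b)" "continuous (at_left b) g" "a < b"
    and "\<And>x. x \<in> {a<..<b} \<Longrightarrow> f x = g x"
  shows "f b = g b"
proof (rule tendsto_unique)
  show "(f \<longlongrightarrow> f b) (at_left b)" by fact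
  have "(g \<longlongrightarrow> g b) (at_left b)"
    using assms(2) by (simp add: continuous_within)
  then show "(f \<longlongrightarrow> g b) (at_left b)"
    by (rule Lim_transform_eventually)
       (use assms in \<open>auto simp: eventually_at_left_field intro!: exI[of _ a]\<close>)
qed simp

lemma tendsto_at_leftI:
  fixes f g :: "real \<Rightarrow> real"
  assumes "continuous (at_left b) g" "a < b" "\<And>x. x \<in> {a<..b} \<Longrightarrow> f x = g x"
  shows "(f \<longlongrightarrow> f b) (at_left b)"
proof -
  have "(g \<longlongrightarrow> f b) (at_left b)"
    using assms by (simp add: continuous_within)
  then show ?thesis
    by (rule Lim_transform_eventually)
       (use assms in \<open>auto simp: eventually_at_left_field intro!: exI[of _ a]\<close>)
qed

lemma is_threshold_sigma_flux_iff:
  assumes J: "J > 0"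
  shows "is_threshold_sigma (flux J) \<sigma> \<longleftrightarrow> (\<forall>\<rho>\<in>{0..1}. \<sigma> \<rho> = \<rho> * (1 - \<rho>) / J)"
proof
  have cont: "continuous (at_left 1) (\<lambda>\<rho>. \<rho> * (1 - \<rho>) / J)"
    using J by (intro continuous_intros) auto
  show "\<forall>\<rho>\<in>{0..1}. \<sigma> \<rho> = \<rho> * (1 - \<rho>) / J" if "is_threshold_sigma (flux J) \<sigma>"
  proof -
    have sol: "sigma_solution (flux J) 1 \<sigma>" and lim: "(\<sigma> \<longlongrightarrow> \<sigma> 1) (at_left 1)"
      using that by (simp_all add: is_threshold_sigma_def)
    have eq: "\<sigma> \<rho> = \<rho> * (1 - \<rho>) / J" if "\<rho> \<in> {0..<1}" for \<rho>
      using sigma_solution_flux_unique[OF J zero_less_one order_refl sol that] .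
    moreover have "\<sigma> 1 = 1 * (1 - 1) / J"
      using eq by (intro tendsto_at_left_eqI[OF lim cont zero_less_one]) auto
    ultimately show ?thesis
      by (metis atLeastAtMost_iff atLeastLessThan_iff order_less_le)
  qed
  show "is_threshold_sigma (flux J) \<sigma>" if "\<forall>\<rho>\<in>{0..1}. \<sigma> \<rho> = \<rho> * (1 - \<rho>) / J"
    unfolding is_threshold_sigma_def
    using that sigma_solution_flux_formula[OF J, of \<sigma>] sigma_solution_flux_unique[OF J]
      tendsto_at_leftI[OF cont, of 0 \<sigma>]
    by auto
qed

section \<open>The threshold function \<gamma>\<close>

definition gamma_formula :: "real \<Rightarrow> real \<Rightarrow> real" where
  "gamma_formula J \<rho> = \<rho>\<^sup>2 * (1 - \<rho>) * (\<rho> - 4 * J / (J + 1)\<^sup>2) / (J * (\<rho> - 2 / (J + 1))\<^sup>2)"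

context
  fixes J c :: real
  assumes J: "J > 1" and c: "c = 2 / (J + 1)"
begin

lemma inflection_bounds: "0 < c" "c < 1"
  using J by (auto simp: c)

text \<open>Since \<open>4 * J / (J + 1)\<^sup>2 = 2 * c - c\<^sup>2\<close>, the numerators combine
  through \<open>\<rho> * (\<rho> - 2 * c + c\<^sup>2) - (\<rho> - c)\<^sup>2 = - c\<^sup>2 * (1 -
  \<rho>)\<close>.\<close>

lemma gamma_formula_diff:
  assumes "\<rho> \<noteq> c"
  shows "gamma_formula J \<rho> - \<rho> * (1 - \<rho>) / J = - (c\<^sup>2 * \<rho> * (1 - \<rho>)\<^sup>2) / (J * (\<rho> - c)\<^sup>2)"
proof -
  have "4 * J / (J + 1)\<^sup>2 = 2 * c - c\<^sup>2"
    using J by (simp add: c divide_simps) (simp add: power2_eq_square algebra_simps)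
  then have g: "gamma_formula J \<rho> = \<rho>\<^sup>2 * (1 - \<rho>) * (\<rho> - (2 * c - c\<^sup>2)) / (J * (\<rho> - c)\<^sup>2)"
    by (simp add: gamma_formula_def c)
  have "\<rho> * (1 - \<rho>) / J = \<rho> * (1 - \<rho>) * (\<rho> - c)\<^sup>2 / (J * (\<rho> - c)\<^sup>2)"
    using assms by simp
  moreover have "\<rho>\<^sup>2 * (1 - \<rho>) * (\<rho> - (2 * c - c\<^sup>2)) - \<rho> * (1 - \<rho>) * (\<rho> - c)\<^sup>2
      = - (c\<^sup>2 * \<rho> * (1 - \<rho>)\<^sup>2)"
    by algebra
  ultimately show ?thesis
    unfolding g by (metis diff_divide_distrib)
qed

lemma quad_coeff_eq:
  "quad_coeff J \<rho> = 2 * J * (\<rho> - c) / (c * \<rho>\<^sup>2 * (1 - \<rho>)\<^sup>2)"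
proof -
  have eq: "(J + 1) * \<rho> - 2 = 2 * (\<rho> - c) / c"
    using J by (simp add: c field_simps)
  show ?thesis unfolding quad_coeff_def eq by (simp add: mult_ac)
qed

lemma solves_threshold_ode_gamma_formula:
  "solves_threshold_ode (flux J) (gamma_formula J) {c<..<1}"
proof (subst solves_threshold_ode_flux_iff, safe)
  fix \<rho> assume \<rho>: "\<rho> \<in> {c<..<1}"
  define w where "w = (\<lambda>\<rho>. - (c\<^sup>2 * \<rho> * (1 - \<rho>)\<^sup>2) / (J * (\<rho> - c)\<^sup>2))"
  \<comment> \<open>Logarithmic differentiation of the product \<open>w\<close>; the Bernoulli
    equation divided by \<open>w\<close> then becomes an identity of rational functions.\<close>
  have "(w has_real_derivative w \<rho> * (1 / \<rho> - 2 / (1 - \<rho>) - 2 / (\<rho> - c))) (at \<rho>)"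
    unfolding w_def
    by (rule derivative_eq_intros refl | (use \<rho> J in simp; fail))+
      (use \<rho> J inflection_bounds in \<open>simp add: divide_simps\<close>, algebra)
  also have "w \<rho> * (1 / \<rho> - 2 / (1 - \<rho>) - 2 / (\<rho> - c)) = quad_coeff J \<rho> * (w \<rho>)\<^sup>2 + lin_coeff \<rho> * w \<rho>"
  proof -
    have "quad_coeff J \<rho> * w \<rho> + lin_coeff \<rho> = 1 / \<rho> - 2 / (1 - \<rho>) - 2 / (\<rho> - c)"
      using \<rho> J inflection_bounds unfolding quad_coeff_eq w_def lin_coeff_def
      by (simp add: divide_simps) algebra
    then have "w \<rho> * (1 / \<rho> - 2 / (1 - \<rho>) - 2 / (\<rho> - c)) = w \<rho> * (quad_coeff J \<rho> * w \<rho> + lin_coeff \<rho>)"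
      by (rule arg_cong[OF sym])
    then show ?thesis by (simp add: power2_eq_square distrib_left mult_ac)
  qed
  finally have *: "(w has_real_derivative quad_coeff J \<rho> * (w \<rho>)\<^sup>2 + lin_coeff \<rho> * w \<rho>) (at \<rho>)" .
  have w: "gamma_formula J x - x * (1 - x) / J = w x" if "x \<in> {c<..<1}" for x
    using gamma_formula_diff[of x] that by (simp add: w_def)
  show "((\<lambda>\<rho>. gamma_formula J \<rho> - \<rho> * (1 - \<rho>) / J) has_real_derivative
      quad_coeff J \<rho> * (gamma_formula J \<rho> - \<rho> * (1 - \<rho>) / J)\<^sup>2
      + lin_coeff \<rho> * (gamma_formula J \<rho> - \<rho> * (1 - \<rho>) / J)) (at \<rho>)"
    unfolding w[OF \<rho>]
    by (rule has_field_derivative_transform_within_open[OF *, of "{c<..<1}"]) (use \<rho> w in auto)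
qed (use J inflection_bounds in auto)

text \<open>The numerator has a negative limit at \<open>c\<close>, because \<open>J > 1\<close>
  puts \<open>c\<close> below \<open>4 * J / (J + 1)\<^sup>2\<close>, while the squared denominator
  tends to \<open>0\<close> from above.\<close>

lemma gamma_formula_at_bot: "filterlim (gamma_formula J) at_bot (at_right c)"
proof -
  define n where "n = (\<lambda>\<rho>. \<rho>\<^sup>2 * (1 - \<rho>) * (\<rho> - 4 * J / (J + 1)\<^sup>2) / J)"
  have "(n \<longlongrightarrow> n c) (at_right c)"
    unfolding n_def using J by (intro tendsto_intros) auto
  moreover have "n c < 0"
  proof -
    have "c - 4 * J / (J + 1)\<^sup>2 = 2 * (1 - J) / (J + 1)\<^sup>2"
      using J by (simp add: c divide_simps) (simp add: power2_eq_square algebra_simps)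
    also have "\<dots> < 0" using J by (simp add: divide_neg_pos)
    finally show ?thesis
      using J inflection_bounds by (simp add: n_def divide_neg_pos mult_pos_neg)
  qed
  moreover have "filterlim (\<lambda>\<rho>. inverse ((\<rho> - c)\<^sup>2)) at_top (at_right c)"
  proof (rule filterlim_inverse_at_top)
    have "((\<lambda>\<rho>. (\<rho> - c)\<^sup>2) \<longlongrightarrow> (c - c)\<^sup>2) (at_right c)" by (intro tendsto_intros)
    then show "((\<lambda>\<rho>. (\<rho> - c)\<^sup>2) \<longlongrightarrow> 0) (at_right c)" by simp
    show "\<forall>\<^sub>F \<rho> in at_right c. 0 < (\<rho> - c)\<^sup>2"
      by (auto simp: eventually_at_right_field intro!: exI[of _ "c + 1"])
  qed
  ultimately have "filterlim (\<lambda>\<rho>. n \<rho> * inverse ((\<rho> - c)\<^sup>2)) at_bot (at_right c)"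
    by (rule filterlim_tendsto_neg_mult_at_bot)
  then show ?thesis
    by (simp add: n_def gamma_formula_def[abs_def] c divide_inverse mult_ac)
qed

lemma gamma_solution_flux_formula:
  assumes "\<And>\<rho>. \<rho> \<in> {c<..<1} \<Longrightarrow> d \<rho> = gamma_formula J \<rho>"
  shows "gamma_solution (flux J) c 1 d"
  unfolding gamma_solution_def
proof
  have "\<forall>\<^sub>F \<rho> in at_right c. d \<rho> = gamma_formula J \<rho>"
    using assms inflection_bounds by (auto simp: eventually_at_right_field)
  then show "filterlim d at_bot (at_right c)"
    using gamma_formula_at_bot by (simp cong: filterlim_cong)
  show "solves_threshold_ode (flux J) d {c<..<1}"
    by (rule solves_threshold_ode_cong[OF solves_threshold_ode_gamma_formula]) (use assms in auto)
qed

text \<open>The linear equation for \<open>1 / w\<close> has the integrating factor \<open>(1 - \<rho>)\<^sup>2 / \<rho>\<close>, so that \<open>v\<close> below is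
  constant; the blow-up of \<open>d\<close> forces \<open>v = 0\<close>.\<close>

lemma gamma_solution_flux_unique:
  assumes r: "c < r" "r \<le> 1" and d: "gamma_solution (flux J) c r d" and \<rho>: "\<rho> \<in> {c<..<r}"
  shows "d \<rho> = gamma_formula J \<rho>"
proof -
  define w where "w = (\<lambda>\<rho>. d \<rho> - \<rho> * (1 - \<rho>) / J)"
  \<comment> \<open>The second summand is the antiderivative, vanishing at \<open>c\<close>, of the
    integrating factor times \<open>quad_coeff J\<close>, which is
    \<open>2 * J * (x - c) / (c * x^3)\<close>.\<close>
  define v where "v = (\<lambda>x. (1 - x)\<^sup>2 / x * inverse (w x) + J * (1 / x - 1 / c)\<^sup>2)"
  have d_bot: "filterlim d at_bot (at_right c)" and ode: "solves_threshold_ode (flux J) d {c<..<r}"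
    using d by (auto simp: gamma_solution_def)
  have "((\<lambda>\<rho>. \<rho> * (1 - \<rho>) / J) \<longlongrightarrow> c * (1 - c) / J) (at_right c)"
    using J by (intro tendsto_intros) auto
  moreover have "filterlim (\<lambda>\<rho>. - d \<rho>) at_top (at_right c)"
    using d_bot by (simp add: filterlim_uminus_at_top)
  ultimately have "filterlim (\<lambda>\<rho>. \<rho> * (1 - \<rho>) / J + - d \<rho>) at_top (at_right c)"
    by (rule filterlim_tendsto_add_at_top)
  then have w_bot: "filterlim w at_bot (at_right c)"
    by (simp add: filterlim_uminus_at_bot w_def)
  \<comment> \<open>Only near \<open>c\<close> is \<open>w\<close> known to be nonzero, so
    \<open>1 / w\<close> is used there and the result is extended by uniqueness afterwards.\<close>
  have "\<forall>\<^sub>F x in at_right c. w x < 0 \<and> x < r"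
    using w_bot[unfolded filterlim_at_bot_dense] order_tendstoD(2)[OF tendsto_ident_at r(1)]
    by (intro eventually_conj) auto
  then obtain b where b: "c < b" and wneg: "\<And>x. x \<in> {c<..<b} \<Longrightarrow> w x < 0 \<and> x < r"
    by (auto simp: eventually_at_right_field)
  have v': "(v has_real_derivative 0) (at x)" if x: "x \<in> {c<..<b}" for x
  proof -
    have x': "c < x" "x < r" "0 < x" "x < 1" and neg: "w x < 0"
      using wneg[OF x] x inflection_bounds r by auto
    have w': "(w has_real_derivative quad_coeff J x * (w x)\<^sup>2 + lin_coeff x * w x) (at x)"
      using ode x' solves_threshold_ode_flux_iff[of J c r d] J inflection_bounds r by (simp add: w_def)
    show ?thesis
      unfolding v_def
      by (rule derivative_eq_intros refl w' | (use x' neg in simp; fail))+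
        (use x' neg J inflection_bounds in \<open>simp add: quad_coeff_eq lin_coeff_def divide_simps\<close>, algebra)
  qed
  then obtain k where k: "\<And>x. x \<in> {c<..<b} \<Longrightarrow> v x = k"
    using has_field_derivative_zero_constant[of "{c<..<b}" v]
    by (metis convex_real_interval(8) has_field_derivative_at_within)
  have "(v \<longlongrightarrow> (1 - c)\<^sup>2 / c * 0 + J * (1 / c - 1 / c)\<^sup>2) (at_right c)"
    unfolding v_def using inflection_bounds
    by (intro tendsto_intros filterlim_compose[OF tendsto_inverse_0]
          filterlim_mono[OF w_bot at_bot_le_at_infinity]) auto
  moreover have "(v \<longlongrightarrow> k) (at_right c)"
    by (rule tendsto_eventually) (use k b in \<open>auto simp: eventually_at_right_field\<close>)
  ultimately have "k = 0"
    using tendsto_unique[of "at_right c"] by fastforce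
  define x where "x = (c + b) / 2"
  have x: "x \<in> {c<..<b}" using b by (simp add: x_def)
  have x': "c < x" "x < r" "0 < x" "x < 1" and neg: "w x < 0"
    using wneg[OF x] x inflection_bounds r by auto
  \<comment> \<open>Solving \<open>v x = 0\<close> for \<open>w x\<close> reproduces the difference
    between \<open>gamma_formula J\<close> and \<open>s\<close>.\<close>
  have "v x = 0" using k[OF x] \<open>k = 0\<close> by simp
  then have "(1 - x)\<^sup>2 * (x\<^sup>2 * c\<^sup>2) + J * (c - x)\<^sup>2 * (x * w x) = 0"
    using x' neg J inflection_bounds unfolding v_def by (simp add: divide_simps)
  then have "x * (w x * (J * (x - c)\<^sup>2) + c\<^sup>2 * x * (1 - x)\<^sup>2) = 0"
    by algebra
  then have "w x * (J * (x - c)\<^sup>2) = - (c\<^sup>2 * x * (1 - x)\<^sup>2)"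
    using x' by (simp add: eq_neg_iff_add_eq_0)
  then have "w x = - (c\<^sup>2 * x * (1 - x)\<^sup>2) / (J * (x - c)\<^sup>2)"
    using x' J by (subst eq_divide_eq) simp
  then have eq: "d x = gamma_formula J x"
    using gamma_formula_diff[of x] x' by (simp add: w_def)
  have "solves_threshold_ode (flux J) (gamma_formula J) {c<..<r}"
    using solves_threshold_ode_gamma_formula r by (auto simp: solves_threshold_ode_def)
  from solves_threshold_ode_flux_unique[OF _ _ r(2) ode this _ eq \<rho>] show ?thesis
    using J inflection_bounds x' by auto
qed

lemma is_threshold_gamma_flux_iff:
  "is_threshold_gamma (flux J) c \<gamma> \<longleftrightarrow> (\<forall>\<rho>\<in>{c<..1}. \<gamma> \<rho> = gamma_formula J \<rho>)"
proof
  have cont: "continuous (at_left 1) (gamma_formula J)"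
    unfolding gamma_formula_def[abs_def] using J inflection_bounds c by (intro continuous_intros) auto
  show "\<forall>\<rho>\<in>{c<..1}. \<gamma> \<rho> = gamma_formula J \<rho>" if "is_threshold_gamma (flux J) c \<gamma>"
  proof -
    have sol: "gamma_solution (flux J) c 1 \<gamma>" and lim: "(\<gamma> \<longlongrightarrow> \<gamma> 1) (at_left 1)"
      using that by (simp_all add: is_threshold_gamma_def)
    have eq: "\<gamma> \<rho> = gamma_formula J \<rho>" if "\<rho> \<in> {c<..<1}" for \<rho>
      using gamma_solution_flux_unique[OF inflection_bounds(2) order_refl sol that] .
    moreover have "\<gamma> 1 = gamma_formula J 1"
      by (rule tendsto_at_left_eqI[OF lim cont inflection_bounds(2) eq])
    ultimately show ?thesis
      by (metis greaterThanAtMost_iff greaterThanLessThan_iff order_less_le)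
  qed
  show "is_threshold_gamma (flux J) c \<gamma>" if "\<forall>\<rho>\<in>{c<..1}. \<gamma> \<rho> = gamma_formula J \<rho>"
    unfolding is_threshold_gamma_def
    using that gamma_solution_flux_formula[of \<gamma>] gamma_solution_flux_unique
      tendsto_at_leftI[OF cont, of c \<gamma>] switches_at_flux_iff[OF J, of c] c inflection_bounds
    by auto
qed

end

theorem theorem1p3:
  fixes J :: real
  assumes "J > 0"
  shows "(\<forall>\<sigma>. is_threshold_sigma (flux J) \<sigma> \<longleftrightarrow> (\<forall>\<rho>\<in>{0..1}. \<sigma> \<rho> = \<rho> * (1 - \<rho>) / J)) \<and>
    (J > 1 \<longrightarrow>
      (\<forall>\<rho>c. switches_at (flux J) \<rho>c \<longleftrightarrow> \<rho>c = 2 / (J + 1)) \<and>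
      (\<forall>\<rho>c \<gamma>. \<rho>c = 2 / (J + 1) \<longrightarrow>
        (is_threshold_gamma (flux J) \<rho>c \<gamma> \<longleftrightarrow>
          (\<forall>\<rho>\<in>{\<rho>c<..1}. \<gamma> \<rho> =
            \<rho>\<^sup>2 * (1 - \<rho>) * (\<rho> - 4 * J / (J + 1)\<^sup>2) / (J * (\<rho> - \<rho>c)\<^sup>2)))))"
  using is_threshold_sigma_flux_iff[OF assms] switches_at_flux_iff is_threshold_gamma_flux_iff
  by (simp add: gamma_formula_def)

end
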